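(* Let $f:\mathbb{R}^n\to\mathbb{R}$ and $G:\mathbb{R}^n\to S^p$ be twice continuously differentiable, and let $(\bar x,\bar y)\in S_{\rm KKT}(0,0)$. Suppose there are $\varepsilon>0$, neighborhoods $U$ of $0\in\mathbb{R}^n$ and $W$ of $0\in S^p$, such that for any $(p_1,p_2)\in U\times W$ and any $(x_{p_1p_2},y_{p_1p_2})\in S_{\rm KKT}(p_1,p_2)\cap\mathbb{B}_\varepsilon(\bar x,\bar y)$ the estimate $$\|x_{p_1p_2}-\bar x\|=O(\|p_1\|+\|p_2\|)$$ holds (that is, $\|x_{p_1p_2}-\bar x\|\le\kappa(\|p_1\|+\|p_2\|)$ with a constant $\kappa>0$ independent of $(p_1,p_2)$ and of $(x_{p_1p_2},y_{p_1p_2})$). Then the Lagrange multiplier $\bar y\in\Lambda(\bar x)$ is noncritical for the problem $\min f(x)$ s.t. $G(x)\in S^p_+$.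
   Context: $S^p$ is the space of real symmetric $p\times p$ matrices with the trace inner product; $S^p_+$ (resp. $S^p_-$) is the cone of positive (resp. negative) semidefinite matrices. $L(x,y)=f(x)+\langle y,G(x)\rangle$ for $(x,y)\in\mathbb{R}^n\times S^p$. $G'(\bar x):\mathbb{R}^n\to S^p$ is the derivative and $G'(\bar x)^*$ its adjoint. $N(x;\Omega)$ is the normal cone of convex analysis to the convex set $\Omega$ at $x\in\Omega$, and empty if $x\notin\Omega$. $\mathbb{B}_\varepsilon(\cdot)$ is the ball of radius $\varepsilon$. For feasible $\bar x$, $\Lambda(\bar x)=\{y\in S^p:\nabla_xL(\bar x,y)=0,\ y\in N(G(\bar x);S^p_+)\}$. For $(p_1,p_2)\in\mathbb{R}^n\times S^p$, the solution map of the canonically perturbed KKT system is $$S_{\rm KKT}(p_1,p_2)=\{(x,y)\in\mathbb{R}^n\times S^p:\ p_1=\nabla_xL(x,y),\ p_2\in -G(x)+N(y;S^p_-)\}.$$ Thus $(\bar x,\bar y)\in S_{\rm KKT}(0,0)$ means that $\bar x$ is feasible and $\bar y\in\Lambda(\bar x)$. For a set $\Omega$ in a finite-dimensional Hilbert space and $z\in\Omega$, the tangent cone is $T(z;\Omega)=\limsup_{t\downarrow0}(\Omega-z)/t$ (outer limit). For a set-valued mapping $F$ with $(u,v)\in\operatorname{gph}F$, the graphical derivative is $DF(u,v)(h)=\{k:(h,k)\in T((u,v);\operatorname{gph}F)\}$. Let $\mathcal N:S^p\rightrightarrows S^p$, $\mathcal N(X)=N(X;S^p_+)$. A multiplier $\bar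 y\in\Lambda(\bar x)$ is critical if there is $\xi\in\mathbb{R}^n$, $\xi\neq0$, with $0\in\nabla^2_{xx}L(\bar x,\bar y)\xi+G'(\bar x)^*\,D\mathcal N(G(\bar x),\bar y)(G'(\bar x)\xi)$; it is noncritical otherwise. *)

theory Defs
  imports "HOL-Analysis.Analysis"
begin

text \<open>
  The space \<open>S\<^sup>p\<close> is the subspace \<open>sym_mats\<close> of the type of all \<open>p \<times> p\<close> matrices. The library's
  inner product there is the entrywise one; on symmetric matrices it is the trace inner product,
  and the library's norm is then the induced (Frobenius) norm.
\<close>

definition sym_mats :: "(real^'p^'p) set" where
  "sym_mats = {X. transpose X = X}"

lemma inner_sym_mats_eq_trace:
  fixes X Y :: "real^'p^'p"
  assumes "X \<in> sym_mats"
  shows "X \<bullet> Y = trace (X ** Y)"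
proof -
  have "X $ i $ j = X $ j $ i" for i j
    using assms by (simp add: sym_mats_def transpose_def vec_eq_iff)
  then have "X \<bullet> Y = (\<Sum>i\<in>UNIV. \<Sum>j\<in>UNIV. X $ j $ i * Y $ i $ j)"
    by (simp add: inner_vec_def)
  also have "\<dots> = (\<Sum>j\<in>UNIV. \<Sum>i\<in>UNIV. X $ j $ i * Y $ i $ j)"
    by (rule sum.swap)
  finally show ?thesis
    by (simp add: trace_def matrix_matrix_mult_def)
qed

definition psd_cone :: "(real^'p^'p) set" where
  "psd_cone = {X \<in> sym_mats. \<forall>v. 0 \<le> v \<bullet> (X *v v)}"

definition nsd_cone :: "(real^'p^'p) set" where
  "nsd_cone = {X \<in> sym_mats. \<forall>v. v \<bullet> (X *v v) \<le> 0}"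

definition twice_cont_diff :: "('a::real_normed_vector \<Rightarrow> 'b::real_normed_vector) \<Rightarrow> bool" where
  "twice_cont_diff h \<longleftrightarrow>
     (\<exists>(h' :: 'a \<Rightarrow> 'a \<Rightarrow>\<^sub>L 'b) (h'' :: 'a \<Rightarrow> 'a \<Rightarrow>\<^sub>L ('a \<Rightarrow>\<^sub>L 'b)).
        (\<forall>x. (h has_derivative blinfun_apply (h' x)) (at x)) \<and>
        (\<forall>x. (h' has_derivative blinfun_apply (h'' x)) (at x)) \<and>
        continuous_on UNIV h'')"

definition gradient :: "('a::real_inner \<Rightarrow> real) \<Rightarrow> 'a \<Rightarrow> 'a" where
  "gradient h x = (THE D. GDERIV h x :> D)"

text \<open>
  The Hessian is an operator: \<open>hessian h x \<xi>\<close> is the Hessian of \<open>h\<close> at \<open>x\<close> applied to \<open>\<xi>\<close>.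
\<close>

definition hessian :: "('a::real_inner \<Rightarrow> real) \<Rightarrow> 'a \<Rightarrow> 'a \<Rightarrow> 'a" where
  "hessian h x = frechet_derivative (gradient h) (at x)"

text \<open>
  The normal cone is taken in an ambient subspace \<open>E\<close>, since normals to \<open>S\<^sup>p\<^sub>+\<close> and \<open>S\<^sup>p\<^sub>-\<close> have to be
  symmetric.
\<close>

definition normal_cone_in :: "'a::real_inner set \<Rightarrow> 'a set \<Rightarrow> 'a \<Rightarrow> 'a set" where
  "normal_cone_in E \<Omega> x =
     (if x \<in> \<Omega> then {v \<in> E. \<forall>z\<in>\<Omega>. v \<bullet> (z - x) \<le> 0} else {})"

text \<open>
  Outer (Painleve-Kuratowski) limit of \<open>F t\<close> as \<open>t\<close> decreases to 0.
\<close>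

definition outer_limit_right0 :: "(real \<Rightarrow> 'a::topological_space set) \<Rightarrow> 'a set" where
  "outer_limit_right0 F =
     {w. \<exists>(t :: nat \<Rightarrow> real) (u :: nat \<Rightarrow> 'a).
           (\<forall>k. 0 < t k) \<and> t \<longlonglongrightarrow> 0 \<and> u \<longlonglongrightarrow> w \<and> (\<forall>k. u k \<in> F (t k))}"

definition tangent_cone :: "'a::real_normed_vector set \<Rightarrow> 'a \<Rightarrow> 'a set" where
  "tangent_cone \<Omega> z = outer_limit_right0 (\<lambda>t. (\<lambda>x. (x - z) /\<^sub>R t) ` \<Omega>)"

definition gph :: "('a \<Rightarrow> 'b set) \<Rightarrow> ('a \<times> 'b) set" where
  "gph F = {(u, v). v \<in> F u}"

definition graphical_derivative ::
  "('a::real_normed_vector \<Rightarrow> 'b::real_normed_vector set) \<Rightarrow> 'a \<Rightarrow> 'b \<Rightarrow> 'a \<Rightarrow> 'b set" where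
  "graphical_derivative F u v h = {k. (h, k) \<in> tangent_cone (gph F) (u, v)}"

definition lagrangian ::
  "(real^'n \<Rightarrow> real) \<Rightarrow> (real^'n \<Rightarrow> real^'p^'p) \<Rightarrow> real^'n \<Rightarrow> real^'p^'p \<Rightarrow> real" where
  "lagrangian f G x y = f x + y \<bullet> G x"

definition normal_psd :: "real^'p^'p \<Rightarrow> (real^'p^'p) set" where
  "normal_psd X = normal_cone_in sym_mats psd_cone X"

definition multipliers ::
  "(real^'n \<Rightarrow> real) \<Rightarrow> (real^'n \<Rightarrow> real^'p^'p) \<Rightarrow> real^'n \<Rightarrow> (real^'p^'p) set" where
  "multipliers f G x =
     {y \<in> sym_mats. gradient (\<lambda>x'. lagrangian f G x' y) x = 0 \<and> y \<in> normal_psd (G x)}"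

definition S_KKT ::
  "(real^'n \<Rightarrow> real) \<Rightarrow> (real^'n \<Rightarrow> real^'p^'p) \<Rightarrow> real^'n \<Rightarrow> real^'p^'p
     \<Rightarrow> ((real^'n) \<times> (real^'p^'p)) set" where
  "S_KKT f G p1 p2 =
     {(x, y). y \<in> sym_mats \<and>
        p1 = gradient (\<lambda>x'. lagrangian f G x' y) x \<and>
        p2 \<in> (\<lambda>z. - G x + z) ` normal_cone_in sym_mats nsd_cone y}"

text \<open>
  Below, \<open>G'(x)\<close> and its adjoint are those of \<open>G\<close> as a map into all matrices. If \<open>G\<close> has symmetric
  values then so does \<open>G'(x)\<close>, and the restriction of this adjoint to \<open>S\<^sup>p\<close> is the adjoint of
  \<open>G'(x)\<close> as a map into \<open>S\<^sup>p\<close>.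
\<close>

definition critical_multiplier ::
  "(real^'n \<Rightarrow> real) \<Rightarrow> (real^'n \<Rightarrow> real^'p^'p) \<Rightarrow> real^'n \<Rightarrow> real^'p^'p \<Rightarrow> bool" where
  "critical_multiplier f G x y \<longleftrightarrow>
     y \<in> multipliers f G x \<and>
     (\<exists>\<xi>. \<xi> \<noteq> 0 \<and>
        0 \<in> (\<lambda>k. hessian (\<lambda>x'. lagrangian f G x' y) x \<xi> + adjoint (frechet_derivative G (at x)) k)
             ` graphical_derivative normal_psd (G x) y (frechet_derivative G (at x) \<xi>))"

definition noncritical_multiplier ::
  "(real^'n \<Rightarrow> real) \<Rightarrow> (real^'n \<Rightarrow> real^'p^'p) \<Rightarrow> real^'n \<Rightarrow> real^'p^'p \<Rightarrow> bool" where
  "noncritical_multiplier f G x y \<longleftrightarrow>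
     y \<in> multipliers f G x \<and> \<not> critical_multiplier f G x y"

end

theory Submission
  imports Defs
begin

text \<open>
  Positive and negative semidefinite matrices are polar to each other, so \<open>Y \<in> N(X; S\<^sup>p\<^sub>+)\<close> holds iff
  \<open>X \<in> N(Y; S\<^sup>p\<^sub>-)\<close>. If \<open>\<xi> \<noteq> 0\<close> witnesses criticality, the graphical derivative supplies
  \<open>t\<^sub>k \<down> 0\<close> and pairs \<open>(X\<^sub>k, Y\<^sub>k)\<close> in the graph of the normal cone mapping, and the point
  \<open>(xbar + t\<^sub>k \<xi>, Y\<^sub>k)\<close> solves the KKT system with \<open>p\<^sub>1 = \<nabla>\<^sub>xL(xbar + t\<^sub>k \<xi>, Y\<^sub>k)\<close> and
  \<open>p\<^sub>2 = X\<^sub>k - G (xbar + t\<^sub>k \<xi>)\<close>. Both perturbations are \<open>o(t\<^sub>k)\<close>, while the first component is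
  at distance \<open>t\<^sub>k \<parallel>\<xi>\<parallel>\<close> from \<open>xbar\<close>, contradicting the estimate.
\<close>

section \<open>Polarity of the semidefinite cones\<close>

text \<open>The rank-one matrix v v^T. Pairing a matrix with it evaluates the quadratic form at v,
  so these matrices serve as test elements for both cones.\<close>

definition outer_square :: "real^'p \<Rightarrow> real^'p^'p" where
  "outer_square v = (\<chi> i j. v $ i * v $ j)"

lemma inner_matrix_vector: "v \<bullet> (X *v w) = (\<Sum>i\<in>UNIV. \<Sum>j\<in>UNIV. v $ i * X $ i $ j * w $ j)"
  for X :: "real^'p^'p"
  by (simp add: inner_vec_def matrix_vector_mult_def sum_distrib_left mult.assoc)

lemma inner_outer_square: "X \<bullet> outer_square v = v \<bullet> (X *v v)"
  by (simp add: inner_matrix_vector outer_square_def) (simp add: inner_vec_def mult_ac)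

lemma quadratic_form_outer_square: "w \<bullet> (outer_square v *v w) = (v \<bullet> w)\<^sup>2"
proof -
  have "w \<bullet> (outer_square v *v w) = (\<Sum>i\<in>UNIV. \<Sum>j\<in>UNIV. (v $ i * w $ i) * (v $ j * w $ j))"
    by (simp add: inner_matrix_vector outer_square_def mult_ac)
  then show ?thesis
    by (simp add: power2_eq_square sum_product inner_vec_def)
qed

lemma subspace_sym_mats: "subspace sym_mats"
  by (auto simp: subspace_def sym_mats_def transpose_def vec_eq_iff)

lemma outer_square_psd: "outer_square v \<in> psd_cone"
  by (simp add: psd_cone_def quadratic_form_outer_square)
     (simp add: sym_mats_def transpose_def outer_square_def mult.commute)

lemma uminus_nsd_iff: "- X \<in> psd_cone \<longleftrightarrow> X \<in> nsd_cone"
  using subspace_neg[OF subspace_sym_mats, of X] subspace_neg[OF subspace_sym_mats, of "- X"]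
  by (auto simp: psd_cone_def nsd_cone_def inner_matrix_vector sum_negf)

lemma sym_mats_inner_commute:
  assumes "X \<in> sym_mats"
  shows "v \<bullet> (X *v w) = w \<bullet> (X *v v)"
proof -
  have "v \<bullet> (X *v w) = (v v* X) \<bullet> w"
    by (simp add: dot_lmul_matrix)
  also have "v v* X = X *v v"
    using assms transpose_matrix_vector[of X v] by (simp add: sym_mats_def)
  finally show ?thesis
    by (simp add: inner_commute)
qed

text \<open>The form at v + s w is a nonnegative quadratic polynomial in s, so its discriminant
  cannot be positive.\<close>

lemma psd_Cauchy_Schwarz:
  assumes "X \<in> psd_cone"
  shows "(v \<bullet> (X *v w))\<^sup>2 \<le> (v \<bullet> (X *v v)) * (w \<bullet> (X *v w))"
proof -
  define a b c where "a = v \<bullet> (X *v v)" and "b = v \<bullet> (X *v w)" and "c = w \<bullet> (X *v w)"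
  have b: "w \<bullet> (X *v v) = b"
    using assms unfolding b_def psd_cone_def by (simp add: sym_mats_inner_commute)
  have q: "0 \<le> a + 2 * s * b + s\<^sup>2 * c" for s
  proof -
    have "0 \<le> (v + s *\<^sub>R w) \<bullet> (X *v (v + s *\<^sub>R w))"
      using assms by (simp add: psd_cone_def)
    also have "\<dots> = a + 2 * s * b + s\<^sup>2 * c"
      by (simp add: matrix_vector_right_distrib matrix_vector_mult_scaleR inner_add_left
          inner_add_right a_def[symmetric] b_def[symmetric] c_def[symmetric] b
          power2_eq_square algebra_simps)
    finally show ?thesis .
  qed
  have "c \<ge> 0"
    using assms by (simp add: psd_cone_def c_def)
  have "b\<^sup>2 \<le> a * c"
  proof (cases "c = 0")
    case True
    have "b = 0"
    proof (rule ccontr)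
      assume "b \<noteq> 0"
      \<comment> \<open>With c = 0 the polynomial is affine in s, and this s gives it the value
        -1.\<close>
      then show False
        using q[of "- (a + 1) / (2 * b)"] q[of 0] True by (simp add: field_simps)
    qed
    then show ?thesis
      using True by simp
  next
    \<comment> \<open>The value s = -b/c minimizes the polynomial, and the minimum is a -
      b^2/c.\<close>
    case False
    with \<open>c \<ge> 0\<close> q[of "- b / c"] show ?thesis
      by (simp add: field_simps power2_eq_square)
  qed
  then show ?thesis
    by (simp add: a_def b_def c_def)
qed

lemma axis_quadratic_form: "axis i 1 \<bullet> (X *v axis j 1) = X $ i $ j"
  for X :: "real^'p^'p"
  by (simp add: matrix_vector_mul_component inner_axis' inner_axis)

text \<open>
  Cholesky elimination: subtracting the square of a scaled column clears a nonzero diagonal entry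
  and keeps the matrix positive semidefinite.
\<close>

lemma inner_psd_nonneg:
  assumes "X \<in> psd_cone" and "W \<in> psd_cone"
  shows "0 \<le> X \<bullet> W"
  using assms(1)
proof (induction "card {i. X $ i $ i \<noteq> 0}" arbitrary: X rule: less_induct)
  case less
  have nonneg: "0 \<le> Z $ i $ i" if "Z \<in> psd_cone" for Z :: "real^'a^'a" and i
    using that axis_quadratic_form[of i Z i] unfolding psd_cone_def
    by (metis (mono_tags, lifting) mem_Collect_eq)
  show ?case
  proof (cases "\<exists>i. X $ i $ i \<noteq> 0")
    case False
    \<comment> \<open>By Cauchy-Schwarz the square of an entry is at most the product of two
      diagonal entries, which vanish here.\<close>
    have "X $ i $ j = 0" for i j
      using psd_Cauchy_Schwarz[OF less.prems, of "axis i 1" "axis j 1"] False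
      by (simp add: axis_quadratic_form)
    then have "X = 0"
      by (simp add: vec_eq_iff)
    then show ?thesis
      by simp
  next
    case True
    then obtain i where i: "X $ i $ i \<noteq> 0"
      by blast
    define d where "d = X $ i $ i"
    have d: "d > 0"
      using i nonneg[OF less.prems, of i] by (simp add: d_def)
    \<comment> \<open>Column i of \<open>X\<close>, scaled so that v v^T agrees with
      \<open>X\<close> in row and column i.\<close>
    define v where "v = (1 / sqrt d) *\<^sub>R (X *v axis i 1)"
    define Y where "Y = X - outer_square v"
    have vw: "(v \<bullet> w)\<^sup>2 = (w \<bullet> (X *v axis i 1))\<^sup>2 / d" for w
      using d by (simp add: v_def power_divide inner_commute)
    have "Y \<in> sym_mats"
      using less.prems outer_square_psd[of v] subspace_diff[OF subspace_sym_mats]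
      unfolding Y_def psd_cone_def by blast
    \<comment> \<open>Nonnegativity of this Schur complement is Cauchy-Schwarz for w and the i-th
      unit vector, divided by d.\<close>
    moreover have "0 \<le> w \<bullet> (Y *v w)" for w
      using psd_Cauchy_Schwarz[OF less.prems, of w "axis i 1"] d
      by (simp add: Y_def matrix_vector_mult_diff_rdistrib inner_diff_right
          quadratic_form_outer_square vw axis_quadratic_form d_def[symmetric] field_simps)
    ultimately have Y: "Y \<in> psd_cone"
      by (simp add: psd_cone_def)
    have diag: "Y $ j $ j = X $ j $ j - (v $ j)\<^sup>2" for j
      by (simp add: Y_def outer_square_def power2_eq_square)
    have "v $ i = d / sqrt d"
      using axis_quadratic_form[of i X i] by (simp add: v_def d_def inner_axis')
    then have "Y $ i $ i = 0"
      using d by (simp add: diag real_div_sqrt d_def[symmetric])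
    \<comment> \<open>No zero on the diagonal is lost: the new entry is minus a square, yet
      nonnegative.\<close>
    moreover have "Y $ j $ j = 0" if "X $ j $ j = 0" for j
      using nonneg[OF Y, of j] that by (simp add: diag)
    ultimately have "{j. Y $ j $ j \<noteq> 0} \<subset> {j. X $ j $ j \<noteq> 0}"
      using i by auto
    then have "0 \<le> Y \<bullet> W"
      using less.hyps Y by (simp add: psubset_card_mono)
    moreover have "0 \<le> outer_square v \<bullet> W"
      using assms(2) inner_outer_square[of W v] by (simp add: psd_cone_def inner_commute)
    ultimately show ?thesis
      by (simp add: Y_def inner_diff_left)
  qed
qed

text \<open>Testing against the matrices v v^T gives one inclusion; the other is
  \<open>inner_psd_nonneg\<close> applied to -Y.\<close>

lemma polar_psd_cone: "{Y \<in> sym_mats. \<forall>Z\<in>psd_cone. Y \<bullet> Z \<le> 0} = nsd_cone"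
proof (intro equalityI subsetI)
  fix Y :: "real^'p^'p" assume "Y \<in> {Y \<in> sym_mats. \<forall>Z\<in>psd_cone. Y \<bullet> Z \<le> 0}"
  then show "Y \<in> nsd_cone"
    using outer_square_psd by (auto simp: nsd_cone_def simp flip: inner_outer_square)
next
  fix Y :: "real^'p^'p" assume "Y \<in> nsd_cone"
  then show "Y \<in> {Y \<in> sym_mats. \<forall>Z\<in>psd_cone. Y \<bullet> Z \<le> 0}"
    using inner_psd_nonneg[of "- Y"] by (auto simp: uminus_nsd_iff) (simp add: nsd_cone_def)
qed

lemma polar_nsd_cone: "{X \<in> sym_mats. \<forall>Z\<in>nsd_cone. X \<bullet> Z \<le> 0} = psd_cone"
proof (intro equalityI subsetI)
  fix X :: "real^'p^'p" assume X: "X \<in> {X \<in> sym_mats. \<forall>Z\<in>nsd_cone. X \<bullet> Z \<le> 0}"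
  have "X \<bullet> - outer_square v \<le> 0" for v
    using X outer_square_psd[of v] uminus_nsd_iff[of "- outer_square v"] by auto
  with X show "X \<in> psd_cone"
    by (auto simp: psd_cone_def inner_outer_square)
next
  fix X :: "real^'p^'p" assume X: "X \<in> psd_cone"
  have "X \<bullet> Z \<le> 0" if "Z \<in> nsd_cone" for Z
    using inner_psd_nonneg[OF X, of "- Z"] that by (simp add: uminus_nsd_iff)
  with X show "X \<in> {X \<in> sym_mats. \<forall>Z\<in>nsd_cone. X \<bullet> Z \<le> 0}"
    by (simp add: psd_cone_def)
qed

text \<open>Testing a normal v at z = 0 and z = 2x bounds the product of v and x from both sides, so
  it is 0. What remains is membership in the polar cone.\<close>

lemma normal_cone_in_cone_iff:
  assumes "0 \<in> C" and "\<And>x. x \<in> C \<Longrightarrow> 2 *\<^sub>R x \<in> C"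
  shows "v \<in> normal_cone_in E C x \<longleftrightarrow> x \<in> C \<and> v \<in> {v \<in> E. \<forall>z\<in>C. v \<bullet> z \<le> 0} \<and> v \<bullet> x = 0"
proof
  assume v: "v \<in> normal_cone_in E C x"
  then have le: "v \<bullet> (z - x) \<le> 0" if "z \<in> C" for z
    using that by (auto simp: normal_cone_in_def split: if_splits)
  have "x \<in> C"
    using v by (auto simp: normal_cone_in_def split: if_splits)
  moreover from this have "v \<bullet> x = 0"
    using le[OF assms(1)] le[OF assms(2)[OF \<open>x \<in> C\<close>]] by (simp add: inner_diff_right)
  ultimately show "x \<in> C \<and> v \<in> {v \<in> E. \<forall>z\<in>C. v \<bullet> z \<le> 0} \<and> v \<bullet> x = 0"
    using v le by (auto simp: normal_cone_in_def inner_diff_right)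
qed (auto simp: normal_cone_in_def inner_diff_right)

lemma psd_cone_scaleR: "0 \<le> c \<Longrightarrow> X \<in> psd_cone \<Longrightarrow> c *\<^sub>R X \<in> psd_cone"
  using subspace_scale[OF subspace_sym_mats]
  by (auto simp: psd_cone_def scaleR_matrix_vector_assoc[symmetric])

lemma nsd_cone_scaleR: "0 \<le> c \<Longrightarrow> X \<in> nsd_cone \<Longrightarrow> c *\<^sub>R X \<in> nsd_cone"
  using psd_cone_scaleR[of c "- X"] by (simp flip: uminus_nsd_iff)

lemma normal_psd_iff: "Y \<in> normal_psd X \<longleftrightarrow> X \<in> psd_cone \<and> Y \<in> nsd_cone \<and> Y \<bullet> X = 0"
proof -
  have "(0 :: real^'a^'a) \<in> psd_cone"
    using subspace_0[OF subspace_sym_mats] by (simp add: psd_cone_def)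
  then show ?thesis
    unfolding normal_psd_def polar_psd_cone[symmetric]
    by (subst normal_cone_in_cone_iff) (auto intro: psd_cone_scaleR)
qed

text \<open>By polarity both sides become the same complementarity system: X psd, Y nsd, X
  orthogonal to Y.\<close>

lemma normal_psd_iff_normal_nsd: "Y \<in> normal_psd X \<longleftrightarrow> X \<in> normal_cone_in sym_mats nsd_cone Y"
proof -
  have "(0 :: real^'a^'a) \<in> nsd_cone"
    using subspace_0[OF subspace_sym_mats] by (simp add: nsd_cone_def)
  then have "X \<in> normal_cone_in sym_mats nsd_cone Y \<longleftrightarrow>
      Y \<in> nsd_cone \<and> X \<in> {X \<in> sym_mats. \<forall>Z\<in>nsd_cone. X \<bullet> Z \<le> 0} \<and> X \<bullet> Y = 0"
    by (intro normal_cone_in_cone_iff nsd_cone_scaleR) auto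
  then show ?thesis
    unfolding normal_psd_iff polar_nsd_cone by (auto simp: inner_commute)
qed

text \<open>In this form a point (X, Y) of the graph of \<open>normal_psd\<close> meets the second
  KKT condition at x as soon as p2 = X - G(x).\<close>

lemma S_KKT_iff:
  "(x, y) \<in> S_KKT f G p1 p2 \<longleftrightarrow>
    y \<in> sym_mats \<and> p1 = gradient (\<lambda>x'. lagrangian f G x' y) x \<and> y \<in> normal_psd (p2 + G x)"
proof -
  have "p2 = - G x + z \<longleftrightarrow> z = p2 + G x" for z
    by (auto simp: algebra_simps)
  then show ?thesis
    by (simp add: S_KKT_def normal_psd_iff_normal_nsd image_iff)
qed

section \<open>Derivatives\<close>

text \<open>The coordinates of the Riesz representative of the derivative. Its uniqueness resolves
  the definite description in \<open>gradient\<close>.\<close>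

lemma gradient_eq_sum_Basis:
  fixes h :: "'a::euclidean_space \<Rightarrow> real"
  assumes "(h has_derivative h') (at x)"
  shows "gradient h x = (\<Sum>b\<in>Basis. h' b *\<^sub>R b)"
proof -
  interpret linear h'
    using assms by (rule has_derivative_linear)
  have "h' = (\<lambda>z. z \<bullet> (\<Sum>b\<in>Basis. h' b *\<^sub>R b))"
  proof
    fix z
    have "h' z = h' (\<Sum>b\<in>Basis. (z \<bullet> b) *\<^sub>R b)"
      by (simp only: euclidean_representation)
    also have "\<dots> = z \<bullet> (\<Sum>b\<in>Basis. h' b *\<^sub>R b)"
      by (simp add: sum scale inner_sum_right mult.commute)
    finally show "h' z = z \<bullet> (\<Sum>b\<in>Basis. h' b *\<^sub>R b)" .
  qed
  then have D: "GDERIV h x :> (\<Sum>b\<in>Basis. h' b *\<^sub>R b)"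
    using assms unfolding gderiv_def by (simp add: inner_commute)
  have "D = D'" if "GDERIV h x :> D" "GDERIV h x :> D'" for D D'
  proof -
    have "(\<lambda>z. z \<bullet> D) = (\<lambda>z. z \<bullet> D')"
      using that unfolding gderiv_def by (intro has_derivative_unique) (simp_all add: inner_commute)
    then have "\<forall>z. z \<bullet> D = z \<bullet> D'"
      by (rule fun_cong[THEN allI])
    then show ?thesis
      by (simp only: vector_eq_ldot)
  qed
  with D show ?thesis
    unfolding gradient_def by blast
qed

lemma adjoint_eq_sum_Basis:
  fixes A :: "'a::euclidean_space \<Rightarrow> 'b::euclidean_space"
  assumes "linear A"
  shows "adjoint A y = (\<Sum>b\<in>Basis. (y \<bullet> A b) *\<^sub>R b)"
proof -
  have "adjoint A y = (\<Sum>b\<in>Basis. (adjoint A y \<bullet> b) *\<^sub>R b)"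
    by (simp only: euclidean_representation)
  then show ?thesis
    by (simp add: adjoint_clauses[OF assms])
qed

text \<open>Composing \<open>h\<close> with the line s -> x + s \<xi> before inserting
  \<open>t\<close> also covers \<xi> = 0.\<close>

lemma has_derivative_directional_LIMSEQ:
  assumes "(h has_derivative h') (at x)" and "t \<longlonglongrightarrow> 0" and "\<And>k. 0 < t k"
  shows "(\<lambda>k. (h (x + t k *\<^sub>R \<xi>) - h x) /\<^sub>R t k) \<longlonglongrightarrow> h' \<xi>"
proof -
  have "((\<lambda>s::real. x + s *\<^sub>R \<xi>) has_derivative (\<lambda>s. s *\<^sub>R \<xi>)) (at 0)"
    by (auto intro!: derivative_eq_intros)
  moreover have "(h has_derivative h') (at (x + 0 *\<^sub>R \<xi>))"
    using assms(1) by simp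
  ultimately have "((\<lambda>s. h (x + s *\<^sub>R \<xi>)) has_derivative (\<lambda>s. h' (s *\<^sub>R \<xi>))) (at (0::real))"
    by (rule has_derivative_compose)
  then have "((\<lambda>s. norm (h (x + s *\<^sub>R \<xi>) - h x - h' (s *\<^sub>R \<xi>)) / norm s) \<longlongrightarrow> 0) (at (0::real))"
    by (simp add: has_derivative_at)
  moreover have "filterlim t (at 0) sequentially"
    using assms(2,3) by (auto simp: filterlim_at less_imp_neq[symmetric] intro!: always_eventually)
  ultimately have "(\<lambda>k. norm (h (x + t k *\<^sub>R \<xi>) - h x - h' (t k *\<^sub>R \<xi>)) / norm (t k)) \<longlonglongrightarrow> 0"
    by (rule filterlim_compose)
  moreover have "norm (h (x + t k *\<^sub>R \<xi>) - h x - h' (t k *\<^sub>R \<xi>)) / norm (t k)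
      = norm ((h (x + t k *\<^sub>R \<xi>) - h x) /\<^sub>R t k - h' \<xi>)" for k
  proof -
    have "(h (x + t k *\<^sub>R \<xi>) - h x) /\<^sub>R t k - h' \<xi>
        = (h (x + t k *\<^sub>R \<xi>) - h x - h' (t k *\<^sub>R \<xi>)) /\<^sub>R t k"
      using assms(3)[of k] linear_scale[OF has_derivative_linear[OF assms(1)]]
      by (simp add: scaleR_diff_right)
    then show ?thesis
      by (simp add: divide_inverse_commute)
  qed
  ultimately have "(\<lambda>k. norm ((h (x + t k *\<^sub>R \<xi>) - h x) /\<^sub>R t k - h' \<xi>)) \<longlonglongrightarrow> 0"
    by (simp only:)
  then show ?thesis
    by (rule LIM_zero_cancel[OF tendsto_norm_zero_cancel])
qed

section \<open>Stability of the KKT system and noncriticality\<close>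

theorem theorem3p2:
  fixes f :: "real^'n \<Rightarrow> real" and G :: "real^'n \<Rightarrow> real^'p^'p"
    and xbar :: "real^'n" and ybar :: "real^'p^'p"
    and U :: "(real^'n) set" and W :: "(real^'p^'p) set" and \<epsilon> \<kappa> :: real
  assumes "twice_cont_diff f" and "twice_cont_diff G" and "\<forall>x. G x \<in> sym_mats"
    and "(xbar, ybar) \<in> S_KKT f G 0 0"
    and "\<epsilon> > 0"
    and "0 \<in> interior U"
    and "W \<subseteq> sym_mats" and "0 \<in> top_of_set sym_mats interior_of W"
    and "\<kappa> > 0"
    and "\<forall>p1\<in>U. \<forall>p2\<in>W. \<forall>(x, y) \<in> S_KKT f G p1 p2 \<inter> cball (xbar, ybar) \<epsilon>.
           norm (x - xbar) \<le> \<kappa> * (norm p1 + norm p2)"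
  shows "noncritical_multiplier f G xbar ybar"
proof -
  obtain f' f'' where f': "\<And>x. (f has_derivative blinfun_apply (f' x)) (at x)"
    and f'': "\<And>x. (f' has_derivative blinfun_apply (f'' x)) (at x)"
    using assms(1) unfolding twice_cont_diff_def by blast
  obtain G' G'' where G': "\<And>x. (G has_derivative blinfun_apply (G' x)) (at x)"
    and G'': "\<And>x. (G' has_derivative blinfun_apply (G'' x)) (at x)"
    using assms(2) unfolding twice_cont_diff_def by blast
  define gL where "gL x y = gradient (\<lambda>x'. lagrangian f G x' y) x" for x y
  have gL: "gL x y = (\<Sum>b\<in>Basis. (f' x b + y \<bullet> G' x b) *\<^sub>R b)" for x y
    unfolding gL_def
    by (rule gradient_eq_sum_Basis)
       (auto simp: lagrangian_def[abs_def] intro!: derivative_eq_intros f' G')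
  \<comment> \<open>The gradient is affine in y. The first term will produce the Hessian at the
    fixed \<open>ybar\<close>, the second the adjoint term.\<close>
  have gL_split: "gL x y = gL x ybar + (\<Sum>b\<in>Basis. ((y - ybar) \<bullet> G' x b) *\<^sub>R b)" for x y
    by (simp add: gL sum.distrib[symmetric] inner_diff_left algebra_simps)
  have fG: "frechet_derivative G (at xbar) = blinfun_apply (G' xbar)"
    using frechet_derivative_at[OF G'] by simp
  have "((\<lambda>x. gL x ybar) has_derivative
      (\<lambda>h. \<Sum>b\<in>Basis. (f'' xbar h b + ybar \<bullet> G'' xbar h b) *\<^sub>R b)) (at xbar)"
    unfolding gL by (auto intro!: derivative_eq_intros f'' G'')
  then have "(\<lambda>x. gL x ybar) differentiable at xbar"
    by (auto simp: differentiable_def)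
  then have hess: "((\<lambda>x. gL x ybar) has_derivative
      hessian (\<lambda>x'. lagrangian f G x' ybar) xbar) (at xbar)"
    unfolding hessian_def frechet_derivative_works gL_def .
  have mult: "ybar \<in> multipliers f G xbar" and gL0: "gL xbar ybar = 0"
    using assms(4) by (auto simp: S_KKT_iff multipliers_def gL_def)
  have False if crit: "critical_multiplier f G xbar ybar"
  proof -
    obtain \<xi> k where \<xi>: "\<xi> \<noteq> 0"
      and k: "k \<in> graphical_derivative normal_psd (G xbar) ybar (G' xbar \<xi>)"
      and crit0: "hessian (\<lambda>x'. lagrangian f G x' ybar) xbar \<xi> + adjoint (blinfun_apply (G' xbar)) k = 0"
      using crit unfolding critical_multiplier_def fG by (auto simp: image_iff)
    obtain t u where t: "\<And>i. 0 < t i" "t \<longlonglongrightarrow> 0" and u: "u \<longlonglongrightarrow> (G' xbar \<xi>, k)"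
      and uin: "\<And>i. u i \<in> (\<lambda>x. (x - (G xbar, ybar)) /\<^sub>R t i) ` gph normal_psd"
      using k unfolding graphical_derivative_def tangent_cone_def outer_limit_right0_def by blast
    \<comment> \<open>Undoing the difference quotients recovers graph points \<open>X i\<close>,
      \<open>Y i\<close>; the primal points move along the line in direction \<xi>.\<close>
    define X Y x where "X i = G xbar + t i *\<^sub>R fst (u i)" and "Y i = ybar + t i *\<^sub>R snd (u i)"
      and "x i = xbar + t i *\<^sub>R \<xi>" for i
    have XY: "Y i \<in> normal_psd (X i)" for i
    proof -
      obtain A B where "B \<in> normal_psd A" "u i = ((A, B) - (G xbar, ybar)) /\<^sub>R t i"
        using uin[of i] by (auto simp: gph_def)
      then show ?thesis
        using t(1)[of i] by (simp add: X_def Y_def)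
    qed
    \<comment> \<open>The residuals of the KKT system at (\<open>x i\<close>, \<open>Y i\<close>),
      which make this point an exact solution of the perturbed system.\<close>
    define p1 p2 where "p1 i = gL (x i) (Y i)" and "p2 i = X i - G (x i)" for i
    have kkt: "(x i, Y i) \<in> S_KKT f G (p1 i) (p2 i)" for i
      using XY[of i] by (auto simp: S_KKT_iff p1_def p2_def gL_def normal_psd_iff nsd_cone_def)
    \<comment> \<open>Symmetry matters because \<open>W\<close> is a neighborhood only relative to
      the symmetric matrices.\<close>
    have p2_sym: "p2 i \<in> sym_mats" for i
      using XY[of i] assms(3) unfolding p2_def
      by (intro subspace_diff[OF subspace_sym_mats]) (simp_all add: normal_psd_iff psd_cone_def)
    have u1: "(\<lambda>i. fst (u i)) \<longlonglongrightarrow> G' xbar \<xi>" and u2: "(\<lambda>i. snd (u i)) \<longlonglongrightarrow> k"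
      using tendsto_fst[OF u] tendsto_snd[OF u] by simp_all
    have x: "x \<longlonglongrightarrow> xbar" and Y: "Y \<longlonglongrightarrow> ybar"
      using tendsto_add[OF tendsto_const tendsto_scaleR[OF t(2) tendsto_const], of xbar \<xi>]
        tendsto_add[OF tendsto_const tendsto_scaleR[OF t(2) u2], of ybar]
      by (simp_all add: x_def[abs_def] Y_def[abs_def])
    have "(\<lambda>i. G' (x i)) \<longlonglongrightarrow> G' xbar"
      using has_derivative_continuous[OF G''] x by (rule isCont_tendsto_compose)
    then have "(\<lambda>i. \<Sum>b\<in>Basis. (snd (u i) \<bullet> G' (x i) b) *\<^sub>R b)
        \<longlonglongrightarrow> (\<Sum>b\<in>Basis. (k \<bullet> G' xbar b) *\<^sub>R b)"
      by (intro tendsto_intros u2)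
    also have "(\<Sum>b\<in>Basis. (k \<bullet> G' xbar b) *\<^sub>R b) = adjoint (blinfun_apply (G' xbar)) k"
      using has_derivative_linear[OF G'] by (rule adjoint_eq_sum_Basis[symmetric])
    finally have adj_lim: "(\<lambda>i. \<Sum>b\<in>Basis. (snd (u i) \<bullet> G' (x i) b) *\<^sub>R b)
        \<longlonglongrightarrow> adjoint (blinfun_apply (G' xbar)) k" .
    have hess_lim: "(\<lambda>i. (gL (x i) ybar - gL xbar ybar) /\<^sub>R t i)
        \<longlonglongrightarrow> hessian (\<lambda>x'. lagrangian f G x' ybar) xbar \<xi>"
      unfolding x_def using hess t(2,1) by (rule has_derivative_directional_LIMSEQ)
    \<comment> \<open>Since \<open>Y i\<close> - \<open>ybar\<close> is \<open>t i\<close> times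
      \<open>snd (u i)\<close>, division leaves a bounded multiplier direction. The two limits add
      up to the criticality equation, hence to 0.\<close>
    have "p1 i /\<^sub>R t i = (gL (x i) ybar - gL xbar ybar) /\<^sub>R t i
        + (\<Sum>b\<in>Basis. (snd (u i) \<bullet> G' (x i) b) *\<^sub>R b)" for i
      unfolding p1_def gL_split[of "x i" "Y i"] gL0
      using t(1)[of i] by (simp add: Y_def scaleR_add_right scaleR_sum_right flip: mult.assoc)
    then have p1t: "(\<lambda>i. p1 i /\<^sub>R t i) \<longlonglongrightarrow> 0"
      using tendsto_add[OF hess_lim adj_lim] crit0 by (simp only:)
    \<comment> \<open>The tangent direction of \<open>X i\<close> and the derivative of G along
      \<xi> coincide, so the first-order terms cancel.\<close>
    have "(\<lambda>i. fst (u i) - (G (x i) - G xbar) /\<^sub>R t i) \<longlonglongrightarrow> G' xbar \<xi> - G' xbar \<xi>"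
      unfolding x_def using has_derivative_directional_LIMSEQ[OF G' t(2,1)] u1
      by (intro tendsto_diff)
    moreover have "p2 i /\<^sub>R t i = fst (u i) - (G (x i) - G xbar) /\<^sub>R t i" for i
      using t(1)[of i] by (simp add: p2_def X_def algebra_simps)
    ultimately have p2t: "(\<lambda>i. p2 i /\<^sub>R t i) \<longlonglongrightarrow> 0"
      by simp
    have "t i \<noteq> 0" for i
      using t(1)[of i] by simp
    then have p1: "p1 \<longlonglongrightarrow> 0" and p2: "p2 \<longlonglongrightarrow> 0"
      using tendsto_scaleR[OF t(2) p1t] tendsto_scaleR[OF t(2) p2t] by simp_all
    obtain V where V: "open V" "0 \<in> V" "sym_mats \<inter> V \<subseteq> W"
      using assms(8) unfolding interior_of_def by (auto simp: openin_open)
    have "\<forall>\<^sub>F i in sequentially. p1 i \<in> U"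
      using topological_tendstoD[OF p1 open_interior assms(6)] interior_subset
      by (auto elim!: eventually_mono)
    moreover have "\<forall>\<^sub>F i in sequentially. p2 i \<in> W"
      using topological_tendstoD[OF p2 V(1,2)] V(3) p2_sym by (auto elim!: eventually_mono)
    moreover have "\<forall>\<^sub>F i in sequentially. (x i, Y i) \<in> ball (xbar, ybar) \<epsilon>"
      using assms(5) by (intro topological_tendstoD[OF tendsto_Pair[OF x Y]]) auto
    \<comment> \<open>The estimate divided by \<open>t i\<close>; its left side is then the constant
      norm of \<xi>, while the right side tends to 0.\<close>
    ultimately have "\<forall>\<^sub>F i in sequentially.
        norm \<xi> \<le> \<kappa> * (norm (p1 i /\<^sub>R t i) + norm (p2 i /\<^sub>R t i))"
    proof eventually_elim
      case (elim i)
      then have "norm (x i - xbar) \<le> \<kappa> * (norm (p1 i) + norm (p2 i))"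
        using assms(10) kkt[of i] ball_subset_cball by fast
      then show ?case
        using t(1)[of i] by (simp add: x_def field_simps)
    qed
    moreover have "(\<lambda>i. \<kappa> * (norm (p1 i /\<^sub>R t i) + norm (p2 i /\<^sub>R t i)))
        \<longlonglongrightarrow> \<kappa> * (norm (0::real^'n) + norm (0::real^'p^'p))"
      by (intro tendsto_intros p1t p2t)
    ultimately have "norm \<xi> \<le> \<kappa> * (norm (0::real^'n) + norm (0::real^'p^'p))"
      by (rule tendsto_lowerbound[OF _ _ sequentially_bot, rotated])
    with \<xi> show False
      by simp
  qed
  with mult show ?thesis
    unfolding noncritical_multiplier_def by blast
qed

end
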